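(* Let the matrices $A_{II}^{(i)},A_{I\Gamma}^{(i)},A_{\Gamma I}^{(i)},A_{\Gamma\Gamma}^{(i)}$, $I_{\Gamma\Gamma}^{(i)}$ ($i\in\{1,\dots,p\}$), $M_{\Gamma\Gamma}$, and the block matrices $A$ and $M$ be as described in the context. Assume that there are entry-wise non-negative matrices $W_{\Gamma\Gamma}^{(i)}\ge 0$, $i\in\{1,\dots,p\}$, such that $$A_{\Gamma\Gamma}^{(i)}=W_{\Gamma\Gamma}^{(i)}\circ A_{\Gamma\Gamma},\qquad I_{\Gamma\Gamma}^{(i)}=W_{\Gamma\Gamma}^{(i)}\circ I_{\Gamma\Gamma}\qquad\text{for all } i,$$ where $\circ$ denotes the entry-wise product. If $M_{\Gamma\Gamma}$ is diagonal and $$\rho(|I-M^{-1}A|)<1,$$ then the asynchronous primal Schur method is convergent.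
   Context: Matrices and vectors have entries in $\mathbb{K}=\mathbb{R}$ or $\mathbb{C}$. $\rho(\cdot)$ is the spectral radius, $|\mathcal A|$ is the entry-wise absolute value of a matrix or vector $\mathcal A$, and $I$ is the identity matrix. Setting (primal Schur domain decomposition with $p$ subdomains and interface $\Gamma$). For each $i\in\{1,\dots,p\}$ one is given matrices $A_{II}^{(i)}$ (square, nonsingular), $A_{I\Gamma}^{(i)}$, $A_{\Gamma I}^{(i)}$, $A_{\Gamma\Gamma}^{(i)}$ and vectors $b_I^{(i)}$, $b_\Gamma^{(i)}$ of compatible sizes; the size of the $I$-blocks may depend on $i$, and the index $\Gamma$ refers to one common finite index set. (When subdomain $i$ touches only a part $\Gamma_l$ of $\Gamma$, these blocks are obtained from local blocks through a Boolean restriction matrix $R^{(i)}_{\Gamma_l\Gamma}$ from $\Gamma$ to $\Gamma_l$, e.g. $A_{\Gamma\Gamma}^{(i)}={R^{(i)}_{\Gamma_l\Gamma}}^{\mathsf T}A^{(i)}_{\Gamma_l\Gamma_l}R^{(i)}_{\Gamma_l\Gamma}$.) Define $$S_{\Gamma\Gamma}^{(i)}:=A_{\Gamma\Gamma}^{(i)}-A_{\Gamma I}^{(i)}{A_{II}^{(i)}}^{-1}A_{I\Gamma}^{(i)},\quad d_\Gamma^{(i)}:=b_\Gamma^{(i)}-A_{\Gamma I}^{(i)}{A_{II}^{(i)}}^{-1}b_I^{(i)},\quad S_{\Gamma\Gamma}:=\sum_{i=1}^pS_{\Gamma\Gamma}^{(i)},\quad d_\Gamma:=\sum_{i=1}^pd_\Gamma^{(i)}.$$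 The interface problem is $S_{\Gamma\Gamma}x_\Gamma=d_\Gamma$. Let $I_{\Gamma\Gamma}$ be the identity matrix on $\Gamma$, let $M_{\Gamma\Gamma}$ be a nonsingular matrix on $\Gamma$, and let $I_{\Gamma\Gamma}^{(1)},\dots,I_{\Gamma\Gamma}^{(p)}$ be matrices on $\Gamma$ with $\sum_{i=1}^pI_{\Gamma\Gamma}^{(i)}=I_{\Gamma\Gamma}$. Block matrices: $$A:=\begin{bmatrix}A_{II}^{(1)}&&0&A_{I\Gamma}^{(1)}\\ &\ddots&&\vdots\\ 0&&A_{II}^{(p)}&A_{I\Gamma}^{(p)}\\ A_{\Gamma I}^{(1)}&\cdots&A_{\Gamma I}^{(p)}&A_{\Gamma\Gamma}\end{bmatrix},\quad A_{\Gamma\Gamma}:=\sum_{i=1}^pA_{\Gamma\Gamma}^{(i)},\qquad M:=\begin{bmatrix}A_{II}^{(1)}&&0&0\\ &\ddots&&\vdots\\ 0&&A_{II}^{(p)}&0\\ 0&\cdots&0&M_{\Gamma\Gamma}\end{bmatrix}.$$ Asynchronous primal Schur method. Given initial vectors $x_\Gamma^{(i),0}$ ($i\in\{1,\dots,p\}$), sets $P^{(k)}\subseteq\{1,\dots,p\}$ ($k\in\mathbb{N}$) and maps $\tau_j^i:\mathbb{N}\to\mathbb{N}$ ($i,j\in\{1,\dots,p\}$) with $\tau_j^i(k)\le k$, such that (a) for every $i$, the set $\{k\in\mathbb{N}: i\in P^{(k)}\}$ is infinite, and (b) for all $i,j$, $\lim_{k\to\infty}\tau_j^i(k)=+\infty$,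 the method generates, for $k\in\mathbb{N}$ and $i\in\{1,\dots,p\}$, $$y_\Gamma^{(i),k}:=I_{\Gamma\Gamma}^{(i)}x_\Gamma^{(i),k}+M_{\Gamma\Gamma}^{-1}\left(d_\Gamma^{(i)}-S_{\Gamma\Gamma}^{(i)}x_\Gamma^{(i),k}\right),\qquad x_\Gamma^{(i),k+1}=\begin{cases}\sum_{j=1}^py_\Gamma^{(j),\tau_j^i(k)},& i\in P^{(k)},\\ x_\Gamma^{(i),k},& i\notin P^{(k)}.\end{cases}$$ The method is called convergent if, for all choices of the initial vectors $x_\Gamma^{(i),0}$, of sets $P^{(k)}\subseteq\{1,\dots,p\}$ such that $\{k\in\mathbb{N}: i\in P^{(k)}\}$ is infinite for every $i$, and of maps $\tau_j^i:\mathbb{N}\to\mathbb{N}$ such that $\tau_j^i(k)\le k$ for all $k$ and $\lim_{k\to\infty}\tau_j^i(k)=+\infty$ for all $i,j$, each sequence $(x_\Gamma^{(i),k})_{k}$, $i\in\{1,\dots,p\}$, converges as $k\to\infty$ to the solution $x_\Gamma$ of $S_{\Gamma\Gamma}x_\Gamma=d_\Gamma$. *)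

theory Defs
  imports Complex_Main "Jordan_Normal_Form.Gauss_Jordan_Elimination"
    "Jordan_Normal_Form.Spectral_Radius"
begin

text \<open>
  The scalars live in a type of class \<open>real_normed_field\<close>. Both \<open>real\<close> and \<open>complex\<close>
  are instances; up to isometric isomorphism they are the only ones (Gelfand--Mazur).
\<close>

section \<open>Matrix operations\<close>

text \<open>Meaningful only for invertible matrices, see the lemma below.\<close>

definition mat_inv :: "'a :: field mat \<Rightarrow> 'a mat" where
  "mat_inv A = the (mat_inverse A)"

lemma mat_inv_invertible:
  assumes A: "A \<in> carrier_mat n n" and inv: "invertible_mat A"
  shows "mat_inv A \<in> carrier_mat n n" "A * mat_inv A = 1\<^sub>m n" "mat_inv A * A = 1\<^sub>m n"
proof -
  from inv obtain B where AB: "A * B = 1\<^sub>m n" and BA: "B * A = 1\<^sub>m (dim_row B)"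
    using A unfolding invertible_mat_def inverts_mat_def by auto
  have "dim_col B = n" using arg_cong[OF AB, of dim_col] by simp
  moreover have "dim_row B = n" using arg_cong[OF BA, of dim_col] A by simp
  ultimately have B: "B \<in> carrier_mat n n" by auto
  have "A \<in> Units (ring_mat TYPE('a) n ())"
    unfolding Units_def ring_mat_def using A B AB BA by auto
  then obtain C where C: "mat_inverse A = Some C"
    using mat_inverse(1)[OF A, of "()"] by (cases "mat_inverse A") auto
  from mat_inverse(2)[OF A C]
  show "mat_inv A \<in> carrier_mat n n" "A * mat_inv A = 1\<^sub>m n" "mat_inv A * A = 1\<^sub>m n"
    unfolding mat_inv_def C by auto
qed

definition abs_mat :: "'a :: real_normed_field mat \<Rightarrow> real mat" where
  "abs_mat A = map_mat norm A"

definition real_spectral_radius :: "real mat \<Rightarrow> real" where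
  "real_spectral_radius A = spectral_radius (map_mat complex_of_real A)"

definition hadamard_mat :: "'a :: times mat \<Rightarrow> 'a mat \<Rightarrow> 'a mat" where
  "hadamard_mat A B = mat (dim_row A) (dim_col A) (\<lambda>ij. A $$ ij * B $$ ij)"

definition nonneg_entries :: "real mat \<Rightarrow> bool" where
  "nonneg_entries A \<longleftrightarrow> (\<forall>r < dim_row A. \<forall>c < dim_col A. 0 \<le> A $$ (r, c))"

definition family_sum_mat :: "nat \<Rightarrow> nat \<Rightarrow> (nat \<Rightarrow> 'a :: comm_monoid_add mat) \<Rightarrow> 'a mat" where
  "family_sum_mat p n F = mat n n (\<lambda>rc. \<Sum>i = 1..p. F i $$ rc)"

definition family_sum_vec :: "nat \<Rightarrow> nat \<Rightarrow> (nat \<Rightarrow> 'a :: comm_monoid_add vec) \<Rightarrow> 'a vec" where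
  "family_sum_vec p n f = vec n (\<lambda>r. \<Sum>i = 1..p. f i $ r)"

text \<open>Horizontal counterpart of the library's \<open>append_rows\<close>.\<close>

definition append_cols :: "'a :: zero mat \<Rightarrow> 'a mat \<Rightarrow> 'a mat" where
  "append_cols A B = four_block_mat A B (0\<^sub>m 0 (dim_col A)) (0\<^sub>m 0 (dim_col B))"

section \<open>Primal Schur domain decomposition\<close>

text \<open>
  Subdomains are \<open>{1..p}\<close>; the interface is \<open>{0..<n}\<close>. A family of matrices or vectors indexed by
  subdomains is a function on \<open>nat\<close>, of which only the values on \<open>{1..p}\<close> matter.
\<close>

definition schur_mat :: "'a :: field mat \<Rightarrow> 'a mat \<Rightarrow> 'a mat \<Rightarrow> 'a mat \<Rightarrow> 'a mat" where
  "schur_mat AII AIG AGI AGG = AGG - AGI * mat_inv AII * AIG"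

definition schur_rhs :: "'a :: field mat \<Rightarrow> 'a mat \<Rightarrow> 'a vec \<Rightarrow> 'a vec \<Rightarrow> 'a vec" where
  "schur_rhs AII AGI bI bG = bG - (AGI * mat_inv AII) *\<^sub>v bI"

definition global_mat ::
  "nat \<Rightarrow> nat \<Rightarrow> (nat \<Rightarrow> 'a :: comm_monoid_add mat) \<Rightarrow> (nat \<Rightarrow> 'a mat) \<Rightarrow> (nat \<Rightarrow> 'a mat) \<Rightarrow>
   (nat \<Rightarrow> 'a mat) \<Rightarrow> 'a mat" where
  "global_mat p n AII AIG AGI AGG = four_block_mat
     (diag_block_mat (map AII [1..<Suc p]))
     (foldr append_rows (map AIG [1..<Suc p]) (0\<^sub>m 0 n))
     (foldr append_cols (map AGI [1..<Suc p]) (0\<^sub>m n 0))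
     (family_sum_mat p n AGG)"

definition precond_mat :: "nat \<Rightarrow> nat \<Rightarrow> (nat \<Rightarrow> 'a :: zero mat) \<Rightarrow> 'a mat \<Rightarrow> 'a mat" where
  "precond_mat p n AII MG = (let D = diag_block_mat (map AII [1..<Suc p]) in
     four_block_mat D (0\<^sub>m (dim_row D) n) (0\<^sub>m n (dim_col D)) MG)"

section \<open>The asynchronous method\<close>

text \<open>\<open>P k\<close> is the set of subdomains updated at step \<open>k\<close>, and \<open>\<tau> j i k\<close> is the iteration number
  of the data from subdomain \<open>j\<close> that subdomain \<open>i\<close> uses at step \<open>k\<close>.\<close>

definition async_schedule :: "nat \<Rightarrow> (nat \<Rightarrow> nat set) \<Rightarrow> (nat \<Rightarrow> nat \<Rightarrow> nat \<Rightarrow> nat) \<Rightarrow> bool" where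
  "async_schedule p P \<tau> \<longleftrightarrow>
     (\<forall>k. P k \<subseteq> {1..p}) \<and>
     (\<forall>i \<in> {1..p}. infinite {k. i \<in> P k}) \<and>
     (\<forall>i \<in> {1..p}. \<forall>j \<in> {1..p}. (\<forall>k. \<tau> j i k \<le> k) \<and> filterlim (\<tau> j i) at_top sequentially)"

definition schur_local_update ::
  "'a :: field mat \<Rightarrow> 'a vec \<Rightarrow> 'a mat \<Rightarrow> 'a mat \<Rightarrow> 'a vec \<Rightarrow> 'a vec" where
  "schur_local_update S d J MG x = J *\<^sub>v x + mat_inv MG *\<^sub>v (d - S *\<^sub>v x)"

text \<open>\<open>x i k\<close> is the \<open>k\<close>-th iterate held by subdomain \<open>i\<close>; \<open>S\<close>, \<open>d\<close>, \<open>J\<close> are the families of local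
  Schur complements, local right-hand sides and splittings of the identity.\<close>

definition async_schur_run ::
  "nat \<Rightarrow> nat \<Rightarrow> (nat \<Rightarrow> 'a :: field mat) \<Rightarrow> (nat \<Rightarrow> 'a vec) \<Rightarrow> (nat \<Rightarrow> 'a mat) \<Rightarrow> 'a mat \<Rightarrow>
   (nat \<Rightarrow> nat set) \<Rightarrow> (nat \<Rightarrow> nat \<Rightarrow> nat \<Rightarrow> nat) \<Rightarrow> (nat \<Rightarrow> nat \<Rightarrow> 'a vec) \<Rightarrow> bool" where
  "async_schur_run p n S d J MG P \<tau> x \<longleftrightarrow>
     (\<forall>i \<in> {1..p}. x i 0 \<in> carrier_vec n) \<and>
     (\<forall>k. \<forall>i \<in> {1..p}. x i (Suc k) =
        (if i \<in> P k
         then family_sum_vec p n (\<lambda>j. schur_local_update (S j) (d j) (J j) MG (x j (\<tau> j i k)))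
         else x i k))"

text \<open>The limit has to be the unique solution of the interface problem, whose existence and
  uniqueness are part of the property. Convergence in the finite-dimensional space is entrywise.\<close>

definition async_schur_convergent ::
  "nat \<Rightarrow> nat \<Rightarrow> (nat \<Rightarrow> 'a :: real_normed_field mat) \<Rightarrow> (nat \<Rightarrow> 'a vec) \<Rightarrow> (nat \<Rightarrow> 'a mat) \<Rightarrow>
   'a mat \<Rightarrow> bool" where
  "async_schur_convergent p n S d J MG \<longleftrightarrow>
     (\<exists>z. {v \<in> carrier_vec n. family_sum_mat p n S *\<^sub>v v = family_sum_vec p n d} = {z} \<and>
        (\<forall>P \<tau> x. async_schedule p P \<tau> \<longrightarrow> async_schur_run p n S d J MG P \<tau> x \<longrightarrow>
           (\<forall>i \<in> {1..p}. \<forall>g < n. (\<lambda>k. x i k $ g) \<longlonglongrightarrow> z $ g)))"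

end

theory Submission
  imports Defs
begin

text \<open>
  Write \<open>C\<^sub>j = J\<^sub>j - M\<^sub>G\<^sup>-\<^sup>1 S\<^sub>j\<close>, where \<open>M\<^sub>G\<close> is \<open>MG\<close> and \<open>S\<^sub>j\<close> the \<open>j\<close>-th local Schur complement. The local update is
  affine with linear part \<open>C\<^sub>j\<close>, and since the \<open>J\<^sub>j\<close> sum to the identity, the updates at a solution
  \<open>z\<close> of the interface problem sum to \<open>z\<close>. Hence the error of an updated component is the sum of the
  \<open>C\<^sub>j\<close> applied to delayed errors. If a positive vector \<open>g\<close> satisfies
  \<open>(\<Sum>\<^sub>j \<bar>C\<^sub>j\<bar>) g < g\<close> entrywise, each update shrinks the errors by a fixed factor in the weighted
  maximum norm \<open>max\<^sub>r \<bar>v\<^sub>r\<bar> / g\<^sub>r\<close>, whatever the delays (\<open>async_contraction\<close>). The same inequality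
  leaves the summed Schur complement only the zero kernel vector, so the interface problem has exactly one
  solution (\<open>async_schur_convergent_if_contraction\<close>).

  The vector \<open>g\<close> comes from \<open>T = \<bar>I - M\<^sup>-\<^sup>1 A\<bar>\<close>. Its powers tend to zero, so a partial sum \<open>w\<close> of
  \<open>\<Sum>\<^sub>k T\<^sup>k 1\<close> is positive with \<open>T w < w\<close> (\<open>strictly_contracted_positive_vector\<close>). In block form
  (\<open>abs_iteration_mat\<close>) \<open>T\<close> has blocks \<open>0\<close>, \<open>X\<close>, \<open>Y\<close>, \<open>\<bar>K\<bar>\<close>, where \<open>X\<close> stacks the matrices
  \<open>\<bar>A\<^sub>I\<^sub>I\<^sup>-\<^sup>1 A\<^sub>I\<^sub>G\<bar>\<close> of the subdomains, \<open>Y\<close> juxtaposes the \<open>\<bar>M\<^sub>G\<^sup>-\<^sup>1 A\<^sub>G\<^sub>I\<bar>\<close>, and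
  \<open>K = I - M\<^sub>G\<^sup>-\<^sup>1 A\<^sub>G\<^sub>G\<close>. Eliminating the interior part of \<open>w\<close> shows that its interface part \<open>g\<close>
  satisfies \<open>(Y X + \<bar>K\<bar>) g < g\<close> (\<open>block_elimination_contraction\<close>).

  It remains to see that \<open>\<Sum>\<^sub>j \<bar>C\<^sub>j\<bar> \<le> Y X + \<bar>K\<bar>\<close>. The part of \<open>C\<^sub>j\<close> passing through the interior of
  subdomain \<open>j\<close> contributes at most the \<open>j\<close>-th summand of \<open>Y X\<close> (\<open>local_operator_entry_bound\<close>).
  As \<open>M\<^sub>G\<close> is diagonal, the other part is the entrywise product of the non-negative weights of \<open>j\<close> with
  \<open>K\<close>; these products sum to \<open>K\<close> without cancellation, so their absolute values sum to \<open>\<bar>K\<bar>\<close>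
  (\<open>weighted_splitting_norm_sum\<close>).
\<close>

section \<open>Non-negative matrices of spectral radius below one\<close>

lemma smult_pow_mat:
  fixes A :: "'a :: comm_ring_1 mat"
  assumes A: "A \<in> carrier_mat n n"
  shows "(c \<cdot>\<^sub>m A) ^\<^sub>m k = c ^ k \<cdot>\<^sub>m (A ^\<^sub>m k)"
proof (induction k)
  case 0
  then show ?case using A by auto
next
  case (Suc k)
  have P: "A ^\<^sub>m k \<in> carrier_mat n n" using A by simp
  have "(c \<cdot>\<^sub>m A) ^\<^sub>m Suc k = (c ^ k \<cdot>\<^sub>m (A ^\<^sub>m k)) * (c \<cdot>\<^sub>m A)" using Suc by simp
  also have "\<dots> = c ^ Suc k \<cdot>\<^sub>m (A ^\<^sub>m k * A)"
    using A P by (simp add: mult_smult_assoc_mat[of _ n n _ n] mult_smult_distrib[of _ n n _ n]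
        mult.assoc mult.commute) (auto simp: mult_ac)
  finally show ?case by simp
qed

lemma pow_mat_Suc_left:
  assumes A: "A \<in> carrier_mat n n"
  shows "A ^\<^sub>m Suc k = A * A ^\<^sub>m k"
proof (induction k)
  case 0
  then show ?case using A by simp
next
  case (Suc k)
  have "A ^\<^sub>m k \<in> carrier_mat n n" using A by simp
  then show ?case using A Suc by (simp add: assoc_mult_mat[of _ n n _ n _ n])
qed

text \<open>
  The slack below \<open>1\<close> survives a small dilation; this is what turns boundedness of matrix powers into
  decay.
\<close>

lemma spectral_radius_smult_less_1:
  fixes A :: "complex mat"
  assumes A: "A \<in> carrier_mat n n" and n: "n > 0"
    and c: "c > 0" "c * spectral_radius A < 1"
  shows "spectral_radius (complex_of_real c \<cdot>\<^sub>m A) < 1"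
proof -
  let ?B = "complex_of_real c \<cdot>\<^sub>m A"
  have B: "?B \<in> carrier_mat n n" using A by simp
  obtain e where e: "eigenvalue ?B e" "spectral_radius ?B = norm e"
    using spectral_radius_mem_max(1)[OF B n] by (auto simp: spectrum_def)
  then obtain v where v: "v \<in> carrier_vec n" "v \<noteq> 0\<^sub>v n" "?B *\<^sub>v v = e \<cdot>\<^sub>v v"
    using A by (auto simp: eigenvalue_def eigenvector_def)
  have "A *\<^sub>v v = (e / c) \<cdot>\<^sub>v v"
  proof (rule eq_vecI)
    fix r assume "r < dim_vec ((e / c) \<cdot>\<^sub>v v)"
    hence r: "r < n" using v by simp
    have "(?B *\<^sub>v v) $ r = c * (A *\<^sub>v v) $ r"
      using A v(1) r by (simp add: scalar_prod_def sum_distrib_left mult.assoc)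
    with v(3) show "(A *\<^sub>v v) $ r = ((e / c) \<cdot>\<^sub>v v) $ r" using c r v(1) by (simp add: field_simps)
  qed (use A v in auto)
  hence "e / c \<in> spectrum A"
    using v A by (auto simp: spectrum_def eigenvalue_def eigenvector_def)
  hence "norm (e / c) \<le> spectral_radius A" by (intro spectral_radius_mem_max(2)[OF A n]) auto
  hence "norm e \<le> c * spectral_radius A" using c by (simp add: norm_divide field_simps)
  thus ?thesis using e c by simp
qed

text \<open>
  For \<open>\<rho> < 1\<close> there is \<open>c > 1\<close> with \<open>c \<rho> < 1\<close>. The powers of \<open>c A\<close> are then bounded, by the Jordan
  normal form, so those of \<open>A\<close> are \<open>O(c\<^sup>-\<^sup>k)\<close>.
\<close>

lemma pow_entries_tendsto_0:
  fixes A :: "real mat"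
  assumes A: "A \<in> carrier_mat n n" and rho: "real_spectral_radius A < 1"
    and r: "r < n" and s: "s < n"
  shows "(\<lambda>k. (A ^\<^sub>m k) $$ (r, s)) \<longlonglongrightarrow> 0"
proof -
  define C where "C = map_mat complex_of_real A"
  define \<rho> where "\<rho> = spectral_radius C"
  \<comment> \<open>Any \<open>c\<close> strictly between \<open>1\<close> and \<open>1 / \<rho>\<close> would do; this one is also defined for \<open>\<rho> = 0\<close>.\<close>
  define c where "c = 2 / (1 + \<rho>)"
  have C: "C \<in> carrier_mat n n" using A by (simp add: C_def)
  have n: "n > 0" using r by simp
  have \<rho>: "0 \<le> \<rho>" "\<rho> < 1"
    using spectral_radius_mem_max(1)[OF C n] rho by (auto simp: \<rho>_def C_def real_spectral_radius_def)
  hence c: "c > 1" "c * \<rho> < 1" by (auto simp: c_def field_simps)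
  have "spectral_radius (complex_of_real c \<cdot>\<^sub>m C) < 1"
    using c by (intro spectral_radius_smult_less_1[OF C n]) (auto simp: \<rho>_def)
  then obtain b where b: "\<And>k. norm_bound ((complex_of_real c \<cdot>\<^sub>m C) ^\<^sub>m k) b"
    using spectral_radius_jnf_norm_bound_less_1_upper_triangular[of "complex_of_real c \<cdot>\<^sub>m C" n] C
    by auto
  have bnd: "\<bar>(A ^\<^sub>m k) $$ (r, s)\<bar> \<le> b * (1 / c) ^ k" for k
  proof -
    have P: "A ^\<^sub>m k \<in> carrier_mat n n" using A by simp
    have "C ^\<^sub>m k = map_mat complex_of_real (A ^\<^sub>m k)"
      unfolding C_def by (rule of_real_hom.mat_hom_pow[OF A, symmetric])
    moreover have "norm (((complex_of_real c \<cdot>\<^sub>m C) ^\<^sub>m k) $$ (r, s)) \<le> b"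
      using b[of k] r s C unfolding norm_bound_def smult_pow_mat[OF C] by auto
    ultimately have "c ^ k * \<bar>(A ^\<^sub>m k) $$ (r, s)\<bar> \<le> b"
      using r s A c C by (auto simp: smult_pow_mat[OF C] norm_mult norm_power)
    thus ?thesis using c by (simp add: field_simps)
  qed
  have "(\<lambda>k. b * (1 / c) ^ k) \<longlonglongrightarrow> b * 0"
    using c by (intro tendsto_intros LIMSEQ_power_zero) auto
  hence "(\<lambda>k. b * (1 / c) ^ k) \<longlonglongrightarrow> 0" by simp
  thus ?thesis
    by (rule tendsto_0_le[where K = 1]) (use bnd in \<open>auto intro!: always_eventually intro: order_trans[OF bnd]\<close>)
qed

lemma nonneg_entries_pow:
  assumes A: "A \<in> carrier_mat n n" "nonneg_entries A"
  shows "nonneg_entries (A ^\<^sub>m k)"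
proof (induction k)
  case (Suc k)
  have "A ^\<^sub>m k \<in> carrier_mat n n" using A by simp
  with Suc A show ?case
    by (auto simp: nonneg_entries_def scalar_prod_def intro!: sum_nonneg mult_nonneg_nonneg)
qed (use A in \<open>auto simp: nonneg_entries_def\<close>)

text \<open>
  A substitute for a Perron vector that avoids irreducibility: \<open>w = (\<Sum>k<K. A\<^sup>k) 1\<close> telescopes to
  \<open>A w = w - 1 + A\<^sup>K 1\<close>, and \<open>A\<^sup>K 1 < 1\<close> once \<open>K\<close> is large.
\<close>

lemma strictly_contracted_positive_vector:
  assumes A: "A \<in> carrier_mat n n" "nonneg_entries A" and rho: "real_spectral_radius A < 1"
  shows "\<exists>w \<in> carrier_vec n. \<forall>r < n. 0 < w $ r \<and> (A *\<^sub>v w) $ r < w $ r"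
proof -
  \<comment> \<open>\<open>u k\<close> is the vector \<open>A\<^sup>k 1\<close>.\<close>
  define u where "u k r = (\<Sum>s<n. (A ^\<^sub>m k) $$ (r, s))" for k r
  have P: "A ^\<^sub>m k \<in> carrier_mat n n" for k using A by simp
  have u_nonneg: "0 \<le> u k r" if "r < n" for k r
    using nonneg_entries_pow[OF A, of k] that A(1)
    by (auto simp: u_def nonneg_entries_def intro!: sum_nonneg)
  have u_0: "u 0 r = 1" if "r < n" for r
    using that A by (simp add: u_def)
  have u_Suc: "u (Suc k) r = (\<Sum>s<n. A $$ (r, s) * u k s)" if r: "r < n" for k r
  proof -
    have *: "A ^\<^sub>m Suc k = A * A ^\<^sub>m k" using pow_mat_Suc_left[OF A(1)] . 
    have "u (Suc k) r = (\<Sum>s<n. \<Sum>t<n. A $$ (r, t) * (A ^\<^sub>m k) $$ (t, s))"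
      unfolding u_def * using r P[of k] A
      by (intro sum.cong refl) (auto simp: scalar_prod_def atLeast0LessThan intro!: sum.cong)
    also have "\<dots> = (\<Sum>t<n. A $$ (r, t) * u k t)"
      by (subst sum.swap) (simp add: u_def sum_distrib_left)
    finally show ?thesis .
  qed
  have "\<forall>\<^sub>F k in sequentially. \<forall>r \<in> {..<n}. u k r < 1"
  proof (intro eventually_ball_finite ballI)
    fix r assume r: "r \<in> {..<n}"
    have "(\<lambda>k. u k r) \<longlonglongrightarrow> (\<Sum>s<n. 0)"
      unfolding u_def using r by (intro tendsto_sum pow_entries_tendsto_0[OF A(1) rho]) auto
    thus "\<forall>\<^sub>F k in sequentially. u k r < 1" by (intro order_tendstoD(2)[of _ 0]) auto
  qed auto
  then obtain K0 where K0: "\<And>k r. k \<ge> K0 \<Longrightarrow> r < n \<Longrightarrow> u k r < 1"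
    by (auto simp: eventually_sequentially)
  \<comment> \<open>The successor keeps the summand \<open>A\<^sup>0 1 = 1\<close>, which makes \<open>w\<close> positive.\<close>
  define K where "K = Suc K0"
  define w where "w = vec n (\<lambda>r. \<Sum>k<K. u k r)"
  show ?thesis
  proof (intro bexI[of _ w] allI impI conjI)
    fix r assume r: "r < n"
    have "w $ r = 1 + (\<Sum>k<K0. u (Suc k) r)"
      using r u_0[OF r] unfolding w_def K_def by (simp add: sum.lessThan_Suc_shift del: sum.lessThan_Suc)
    moreover have "(\<Sum>k<K0. u (Suc k) r) \<ge> 0" using r u_nonneg by (intro sum_nonneg) auto
    ultimately show "0 < w $ r" by simp
    have "(A *\<^sub>v w) $ r = (\<Sum>s<n. A $$ (r, s) * (\<Sum>k<K. u k s))"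
      using r A by (auto simp: w_def scalar_prod_def atLeast0LessThan intro!: sum.cong)
    also have "\<dots> = (\<Sum>k<K. u (Suc k) r)"
      unfolding sum_distrib_left by (subst sum.swap) (simp add: u_Suc[OF r])
    also have "\<dots> = w $ r - 1 + u K r"
      using r u_0[OF r] sum.lessThan_Suc_shift[of "\<lambda>k. u k r" K] by (simp add: w_def)
    also have "\<dots> < w $ r" using K0[of K r] r by (simp add: K_def)
    finally show "(A *\<^sub>v w) $ r < w $ r" .
  qed (simp add: w_def)
qed

section \<open>Asynchronous contractions\<close>

text \<open>
  The Chazan--Miranker argument, with \<open>e i k r\<close> the size of entry \<open>r\<close> of the error of process \<open>i\<close> at
  step \<open>k\<close>. Some \<open>\<theta> < 1\<close> satisfies \<open>Q g \<le> \<theta> g\<close>. The errors stay below \<open>b g\<close>. Once all errors are below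
  \<open>\<theta>\<^sup>l b g\<close>, the delays eventually point past that moment, every later update yields an error below
  \<open>\<theta>\<^sup>l\<^sup>+\<^sup>1 b g\<close>, and every process is updated at least once more.
\<close>

lemma async_contraction:
  fixes e :: "nat \<Rightarrow> nat \<Rightarrow> nat \<Rightarrow> real" and Q :: "nat \<Rightarrow> nat \<Rightarrow> nat \<Rightarrow> real"
  assumes sched: "async_schedule p P \<tau>"
    and e_nonneg: "\<And>i k r. e i k r \<ge> 0"
    and Q_nonneg: "\<And>j r c. Q j r c \<ge> 0"
    and upd: "\<And>i k r. i \<in> {1..p} \<Longrightarrow> i \<in> P k \<Longrightarrow> r < n \<Longrightarrow>
      e i (Suc k) r \<le> (\<Sum>j=1..p. \<Sum>c<n. Q j r c * e j (\<tau> j i k) c)"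
    and keep: "\<And>i k r. i \<in> {1..p} \<Longrightarrow> i \<notin> P k \<Longrightarrow> r < n \<Longrightarrow> e i (Suc k) r = e i k r"
    and g_pos: "\<And>r. r < n \<Longrightarrow> g r > 0"
    and contr: "\<And>r. r < n \<Longrightarrow> (\<Sum>j=1..p. \<Sum>c<n. Q j r c * g c) < g r"
    and i: "i \<in> {1..p}" and r: "r < n"
  shows "(\<lambda>k. e i k r) \<longlonglongrightarrow> 0"
proof -
  define h where "h r = (\<Sum>j=1..p. \<Sum>c<n. Q j r c * g c)" for r
  define \<theta> where "\<theta> = Max ((\<lambda>r. h r / g r) ` {..<n})"
  have h_nonneg: "h r \<ge> 0" for r
    unfolding h_def using Q_nonneg g_pos
    by (auto intro!: sum_nonneg mult_nonneg_nonneg intro: less_imp_le)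
  have \<theta>_ge: "h s / g s \<le> \<theta>" if "s < n" for s unfolding \<theta>_def using that by (intro Max_ge) auto
  have "\<theta> \<in> (\<lambda>r. h r / g r) ` {..<n}" unfolding \<theta>_def using r by (intro Max_in) auto
  hence \<theta>: "0 \<le> \<theta>" "\<theta> < 1"
    using h_nonneg g_pos contr[folded h_def] by (auto intro!: divide_nonneg_pos)
  have h_le: "h s \<le> \<theta> * g s" if "s < n" for s
    using \<theta>_ge[OF that] g_pos[OF that] by (simp add: field_simps)
  \<comment> \<open>A crude bound for the initial weighted maximum norm.\<close>
  define b where "b = (\<Sum>j=1..p. \<Sum>c<n. e j 0 c / g c)"
  have b_nonneg: "b \<ge> 0"
    unfolding b_def using e_nonneg g_pos by (intro sum_nonneg divide_nonneg_pos) auto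
  have step: "e j (Suc k) s \<le> \<theta> * B * g s"
    if "j \<in> {1..p}" "j \<in> P k" "s < n" "B \<ge> 0"
      and *: "\<And>l c. l \<in> {1..p} \<Longrightarrow> c < n \<Longrightarrow> e l (\<tau> l j k) c \<le> B * g c" for j k s B
  proof -
    have "e j (Suc k) s \<le> (\<Sum>l=1..p. \<Sum>c<n. Q l s c * e l (\<tau> l j k) c)" using upd that by blast
    also have "\<dots> \<le> (\<Sum>l=1..p. \<Sum>c<n. Q l s c * (B * g c))"
      using * Q_nonneg by (intro sum_mono mult_left_mono) auto
    also have "\<dots> = B * h s" by (simp add: h_def sum_distrib_left mult_ac)
    also have "\<dots> \<le> B * (\<theta> * g s)" using h_le that by (intro mult_left_mono) auto
    finally show ?thesis by (simp add: mult_ac)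
  qed
  have tau_le: "\<tau> l j k \<le> k" if "l \<in> {1..p}" "j \<in> {1..p}" for l j k
    using sched that unfolding async_schedule_def by blast
  have init: "e j 0 s \<le> b * g s" if "j \<in> {1..p}" "s < n" for j s
  proof -
    have "e j 0 s / g s \<le> (\<Sum>c<n. e j 0 c / g c)"
      using that e_nonneg g_pos by (intro member_le_sum) (auto intro!: divide_nonneg_pos)
    also have "\<dots> \<le> b" unfolding b_def using that e_nonneg g_pos
      by (intro member_le_sum[of j "{1..p}" "\<lambda>j. \<Sum>c<n. e j 0 c / g c"])
        (auto intro!: sum_nonneg divide_nonneg_pos)
    finally show ?thesis using g_pos[OF that(2)] by (simp add: field_simps)
  qed
  have bounded: "\<forall>j\<in>{1..p}. \<forall>s<n. e j k s \<le> b * g s" for k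
  proof (induction k rule: less_induct)
    case (less k)
    show ?case
    proof (cases k)
      case 0
      then show ?thesis using init by auto
    next
      case (Suc k')
      show ?thesis
      proof (intro ballI allI impI)
        fix j s assume js: "j \<in> {1..p}" "s < n"
        show "e j k s \<le> b * g s"
        proof (cases "j \<in> P k'")
          case True
          have "e j k s \<le> \<theta> * b * g s"
            unfolding Suc
            by (rule step) (use js True b_nonneg less.IH tau_le Suc in \<open>auto simp: less_Suc_eq_le\<close>)
          also have "\<dots> \<le> 1 * b * g s"
            using \<theta> b_nonneg g_pos[OF js(2)] by (intro mult_right_mono) auto
          finally show ?thesis by simp
        next
          case False
          then show ?thesis using keep[OF js(1) False js(2)] less.IH[of k'] js Suc by simp
        qed
      qed
    qed
  qed
  have stage: "\<exists>K. \<forall>k\<ge>K. \<forall>j\<in>{1..p}. \<forall>s<n. e j k s \<le> \<theta> ^ l * b * g s" for l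
  proof (induction l)
    case 0
    then show ?case using bounded by auto
  next
    case (Suc l)
    then obtain K where K: "\<And>k j s. k \<ge> K \<Longrightarrow> j \<in> {1..p} \<Longrightarrow> s < n \<Longrightarrow> e j k s \<le> \<theta> ^ l * b * g s"
      by blast
    have "\<forall>\<^sub>F k in sequentially. \<forall>j\<in>{1..p}. \<forall>l\<in>{1..p}. \<tau> l j k \<ge> K"
      using sched unfolding async_schedule_def
      by (intro eventually_ball_finite ballI) (auto simp: filterlim_at_top)
    then obtain K' where K': "\<And>k j l. k \<ge> K' \<Longrightarrow> j \<in> {1..p} \<Longrightarrow> l \<in> {1..p} \<Longrightarrow> \<tau> l j k \<ge> K"
      unfolding eventually_sequentially by blast
    have fresh: "e j (Suc k) s \<le> \<theta> ^ Suc l * b * g s"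
      if "j \<in> {1..p}" "j \<in> P k" "s < n" "k \<ge> K'" for j k s
    proof -
      have "e j (Suc k) s \<le> \<theta> * (\<theta> ^ l * b) * g s"
        by (rule step) (use that \<theta> b_nonneg K K' in auto)
      thus ?thesis by (simp add: mult_ac)
    qed
    have "\<forall>j\<in>{1..p}. \<exists>k\<ge>K'. j \<in> P k"
      using sched unfolding async_schedule_def infinite_nat_iff_unbounded_le by blast
    then obtain t where t: "\<And>j. j \<in> {1..p} \<Longrightarrow> t j \<ge> K' \<and> j \<in> P (t j)"
      by metis
    \<comment> \<open>After its first update past \<open>K'\<close>, component \<open>j\<close> is only kept or updated again.\<close>
    have late: "e j (Suc k) s \<le> \<theta> ^ Suc l * b * g s" if js: "j \<in> {1..p}" "s < n" and k: "k \<ge> t j" for j k s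
      using k
    proof (induction k rule: dec_induct)
      case base
      then show ?case using fresh t js by blast
    next
      case (step k)
      show ?case
      proof (cases "j \<in> P (Suc k)")
        case True
        then show ?thesis using fresh[of j "Suc k" s] js step t[OF js(1)] by auto
      next
        case False
        then show ?thesis using keep[OF js(1) False js(2)] step by simp
      qed
    qed
    define T where "T = Suc (Max (t ` {1..p}))"
    have "e j k s \<le> \<theta> ^ Suc l * b * g s" if "k \<ge> T" "j \<in> {1..p}" "s < n" for j k s
    proof -
      have "t j \<le> Max (t ` {1..p})" using that by (intro Max_ge) auto
      then show ?thesis using late[of j s "k - 1"] that by (cases k) (auto simp: T_def)
    qed
    then show ?case by blast
  qed
  show ?thesis
  proof (rule LIMSEQ_I)
    fix \<epsilon> :: real assume "\<epsilon> > 0"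
    have "(\<lambda>l. \<theta> ^ l * b * g r) \<longlonglongrightarrow> 0 * b * g r"
      using \<theta> by (intro tendsto_intros LIMSEQ_power_zero) auto
    hence "\<forall>\<^sub>F l in sequentially. \<theta> ^ l * b * g r < \<epsilon>"
      using \<open>\<epsilon> > 0\<close> by (intro order_tendstoD(2)) auto
    then obtain l where l: "\<theta> ^ l * b * g r < \<epsilon>" by (auto simp: eventually_sequentially)
    from stage[of l] obtain K where "\<forall>k\<ge>K. e i k r \<le> \<theta> ^ l * b * g r" using i r by blast
    with l e_nonneg show "\<exists>K. \<forall>k\<ge>K. norm (e i k r - 0) < \<epsilon>"
      by (auto intro!: exI[of _ K] intro: le_less_trans)
  qed
qed

section \<open>Block matrices over a list of subdomains\<close>

definition vstack :: "nat \<Rightarrow> (nat \<Rightarrow> 'a :: zero mat) \<Rightarrow> nat list \<Rightarrow> 'a mat" where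
  "vstack n F ks = foldr append_rows (map F ks) (0\<^sub>m 0 n)"

definition hstack :: "nat \<Rightarrow> (nat \<Rightarrow> 'a :: zero mat) \<Rightarrow> nat list \<Rightarrow> 'a mat" where
  "hstack n F ks = foldr append_cols (map F ks) (0\<^sub>m n 0)"

lemma vstack_simps [simp]:
  "vstack n F [] = 0\<^sub>m 0 n"
  "vstack n F (k # ks) = F k @\<^sub>r vstack n F ks"
  by (simp_all add: vstack_def)

lemma hstack_simps [simp]:
  "hstack n F [] = 0\<^sub>m n 0"
  "hstack n F (k # ks) = append_cols (F k) (hstack n F ks)"
  by (simp_all add: hstack_def)

lemma vstack_carrier:
  assumes "\<And>i. i \<in> set ks \<Longrightarrow> F i \<in> carrier_mat (m i) n"
  shows "vstack n F ks \<in> carrier_mat (sum_list (map m ks)) n"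
  using assms by (induction ks) auto

lemma append_cols_carrier:
  "A \<in> carrier_mat n k \<Longrightarrow> B \<in> carrier_mat n l \<Longrightarrow> append_cols A B \<in> carrier_mat n (k + l)"
  by (auto simp: append_cols_def)

lemma hstack_carrier:
  assumes "\<And>i. i \<in> set ks \<Longrightarrow> F i \<in> carrier_mat n (m i)"
  shows "hstack n F ks \<in> carrier_mat n (sum_list (map m ks))"
  using assms by (induction ks) (auto intro!: append_cols_carrier)

lemma diag_block_carrier:
  assumes "\<And>i. i \<in> set ks \<Longrightarrow> F i \<in> carrier_mat (m i) (m i)"
  shows "diag_block_mat (map F ks) \<in> carrier_mat (sum_list (map m ks)) (sum_list (map m ks))"
  using assms by (induction ks) (auto simp: Let_def)

lemma diag_block_mult_inverse:
  fixes F G :: "nat \<Rightarrow> 'a :: comm_ring_1 mat"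
  assumes "\<And>i. i \<in> set ks \<Longrightarrow> F i \<in> carrier_mat (m i) (m i)"
    and "\<And>i. i \<in> set ks \<Longrightarrow> G i \<in> carrier_mat (m i) (m i)"
    and "\<And>i. i \<in> set ks \<Longrightarrow> F i * G i = 1\<^sub>m (m i)"
  shows "diag_block_mat (map F ks) * diag_block_mat (map G ks) = 1\<^sub>m (sum_list (map m ks))"
  using assms
proof (induction ks)
  case (Cons k ks)
  let ?s = "sum_list (map m ks)"
  have F: "F k \<in> carrier_mat (m k) (m k)" "diag_block_mat (map F ks) \<in> carrier_mat ?s ?s"
    and G: "G k \<in> carrier_mat (m k) (m k)" "diag_block_mat (map G ks) \<in> carrier_mat ?s ?s"
    using Cons.prems by (auto intro!: diag_block_carrier)
  have "diag_block_mat (map F ks) * diag_block_mat (map G ks) = 1\<^sub>m ?s" "F k * G k = 1\<^sub>m (m k)"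
    using Cons by auto
  with F G show ?case
    by (simp add: Let_def mult_four_block_mat[of _ "m k" "m k" _ ?s _ ?s _ _ "m k" _ ?s])
qed auto

lemma diag_block_mult_vstack:
  fixes F G :: "nat \<Rightarrow> 'a :: comm_ring_1 mat"
  assumes "\<And>i. i \<in> set ks \<Longrightarrow> F i \<in> carrier_mat (m i) (m i)"
    and "\<And>i. i \<in> set ks \<Longrightarrow> G i \<in> carrier_mat (m i) n"
  shows "diag_block_mat (map F ks) * vstack n G ks = vstack n (\<lambda>i. F i * G i) ks"
  using assms
proof (induction ks)
  case (Cons k ks)
  let ?s = "sum_list (map m ks)"
  have F: "F k \<in> carrier_mat (m k) (m k)" "diag_block_mat (map F ks) \<in> carrier_mat ?s ?s"
    and G: "G k \<in> carrier_mat (m k) n" "vstack n G ks \<in> carrier_mat ?s n"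
    and FG: "vstack n (\<lambda>i. F i * G i) ks \<in> carrier_mat ?s n"
    using Cons.prems by (auto intro!: diag_block_carrier vstack_carrier mult_carrier_mat)
  have "diag_block_mat (map F ks) * vstack n G ks = vstack n (\<lambda>i. F i * G i) ks"
    using Cons by auto
  with F G FG show ?case
    by (simp add: Let_def append_rows_def mult_four_block_mat[of _ "m k" "m k" _ ?s _ ?s _ _ n _ 0])
qed auto

lemma mult_hstack:
  fixes L :: "'a :: comm_ring_1 mat"
  assumes L: "L \<in> carrier_mat n n"
    and "\<And>i. i \<in> set ks \<Longrightarrow> G i \<in> carrier_mat n (m i)"
  shows "L * hstack n G ks = hstack n (\<lambda>i. L * G i) ks"
  using assms(2)
proof (induction ks)
  case (Cons k ks)
  let ?s = "sum_list (map m ks)"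
  have G: "G k \<in> carrier_mat n (m k)" "hstack n G ks \<in> carrier_mat n ?s"
    and LG: "hstack n (\<lambda>i. L * G i) ks \<in> carrier_mat n ?s"
    using Cons.prems L by (auto intro!: hstack_carrier mult_carrier_mat)
  have IH: "L * hstack n G ks = hstack n (\<lambda>i. L * G i) ks"
    using Cons by auto
  \<comment> \<open>Padding \<open>L\<close> by empty blocks makes the block product rule applicable.\<close>
  have *: "L = four_block_mat L (0\<^sub>m n 0) (0\<^sub>m 0 n) (0\<^sub>m 0 0)" using L by auto
  have "L * hstack n G (k # ks) = four_block_mat L (0\<^sub>m n 0) (0\<^sub>m 0 n) (0\<^sub>m 0 0) * hstack n G (k # ks)"
    using * by simp
  also have "\<dots> = hstack n (\<lambda>i. L * G i) (k # ks)"
    using IH G L LG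
    by (simp add: append_cols_def mult_four_block_mat[of _ n n _ 0 _ 0 _ _ "m k" _ ?s])
  finally show ?case .
qed (use L in auto)

lemma hstack_mult_vstack_entry:
  fixes F G :: "nat \<Rightarrow> 'a :: comm_ring_1 mat"
  assumes "\<And>i. i \<in> set ks \<Longrightarrow> F i \<in> carrier_mat n (m i)"
    and "\<And>i. i \<in> set ks \<Longrightarrow> G i \<in> carrier_mat (m i) n"
    and rc: "r < n" "c < n"
  shows "(hstack n F ks * vstack n G ks) $$ (r, c) = (\<Sum>i\<leftarrow>ks. (F i * G i) $$ (r, c))"
  using assms(1,2)
proof (induction ks)
  case (Cons k ks)
  let ?s = "sum_list (map m ks)"
  have F: "F k \<in> carrier_mat n (m k)" "hstack n F ks \<in> carrier_mat n ?s"
    and G: "G k \<in> carrier_mat (m k) n" "vstack n G ks \<in> carrier_mat ?s n"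
    using Cons.prems by (auto intro!: hstack_carrier vstack_carrier)
  have "hstack n F (k # ks) * vstack n G (k # ks) =
      four_block_mat (F k * G k + hstack n F ks * vstack n G ks) (0\<^sub>m n 0) (0\<^sub>m 0 n) (0\<^sub>m 0 0)"
    using F G
    by (simp add: append_cols_def append_rows_def
        mult_four_block_mat[of _ n "m k" _ ?s _ 0 _ _ n _ 0])
  moreover have "(hstack n F ks * vstack n G ks) $$ (r, c) = (\<Sum>i\<leftarrow>ks. (F i * G i) $$ (r, c))"
    using Cons by auto
  ultimately show ?case using F G rc by simp
qed (use rc in auto)

lemma map_mat_vstack:
  assumes "\<And>i. i \<in> set ks \<Longrightarrow> F i \<in> carrier_mat (m i) n"
  shows "map_mat f (vstack n F ks) = vstack n (\<lambda>i. map_mat f (F i)) ks"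
  using assms
proof (induction ks)
  case (Cons k ks)
  have F: "F k \<in> carrier_mat (m k) n" "vstack n F ks \<in> carrier_mat (sum_list (map m ks)) n"
    using Cons.prems by (auto intro!: vstack_carrier)
  moreover have "vstack n (\<lambda>i. map_mat f (F i)) ks = map_mat f (vstack n F ks)"
    using Cons by auto
  moreover have "map_mat f (0\<^sub>m k 0) = 0\<^sub>m k 0" for k by auto
  ultimately show ?case
    by (simp add: append_rows_def map_four_block_mat[OF F(1) _ F(2), of _ 0])
qed auto

lemma map_mat_hstack:
  assumes "\<And>i. i \<in> set ks \<Longrightarrow> F i \<in> carrier_mat n (m i)"
  shows "map_mat f (hstack n F ks) = hstack n (\<lambda>i. map_mat f (F i)) ks"
  using assms
proof (induction ks)
  case (Cons k ks)
  have F: "F k \<in> carrier_mat n (m k)" "hstack n F ks \<in> carrier_mat n (sum_list (map m ks))"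
    using Cons.prems by (auto intro!: hstack_carrier)
  moreover have "hstack n (\<lambda>i. map_mat f (F i)) ks = map_mat f (hstack n F ks)"
    using Cons by auto
  moreover have "map_mat f (0\<^sub>m 0 k) = 0\<^sub>m 0 k" for k by auto
  ultimately show ?case
    by (simp add: append_cols_def map_four_block_mat[OF F(1) F(2), of _ 0])
qed auto

section \<open>The global iteration matrix\<close>

lemma mat_inv_unique:
  fixes A B :: "'a :: field mat"
  assumes A: "A \<in> carrier_mat n n" and B: "B \<in> carrier_mat n n" and AB: "A * B = 1\<^sub>m n"
  shows "mat_inv A = B"
proof -
  have "B * A = 1\<^sub>m n" by (rule mat_mult_left_right_inverse[OF A B AB])
  hence "invertible_mat A"
    using A B AB unfolding invertible_mat_def inverts_mat_def by auto
  note inv = mat_inv_invertible[OF A this]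
  have "mat_inv A = mat_inv A * (A * B)" using AB inv by simp
  also have "\<dots> = (mat_inv A * A) * B" by (rule assoc_mult_mat[symmetric, OF inv(1) A B])
  also have "\<dots> = B" using inv B by simp
  finally show ?thesis .
qed

lemma abs_four_block_mat:
  assumes "A \<in> carrier_mat nr1 nc1" "B \<in> carrier_mat nr1 nc2"
    "C \<in> carrier_mat nr2 nc1" "D \<in> carrier_mat nr2 nc2"
  shows "abs_mat (four_block_mat A B C D) =
    four_block_mat (abs_mat A) (abs_mat B) (abs_mat C) (abs_mat D)"
  unfolding abs_mat_def using assms by (rule map_four_block_mat)

text \<open>
  The interior blocks of \<open>M\<close> and \<open>A\<close> agree, so the interior diagonal block of \<open>I - M\<^sup>-\<^sup>1 A\<close> vanishes,
  and \<open>M\<^sup>-\<^sup>1\<close> acts on the other blocks one subdomain at a time.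
\<close>

lemma abs_iteration_mat:
  fixes AII :: "nat \<Rightarrow> 'a :: real_normed_field mat"
  assumes AII: "\<And>i. i \<in> {1..p} \<Longrightarrow> AII i \<in> carrier_mat (m i) (m i)"
    and AII_inv: "\<And>i. i \<in> {1..p} \<Longrightarrow> invertible_mat (AII i)"
    and AIG: "\<And>i. i \<in> {1..p} \<Longrightarrow> AIG i \<in> carrier_mat (m i) n"
    and AGI: "\<And>i. i \<in> {1..p} \<Longrightarrow> AGI i \<in> carrier_mat n (m i)"
    and MG: "MG \<in> carrier_mat n n" and MG_inv: "invertible_mat MG"
  defines "ks \<equiv> [1..<Suc p]" and "N \<equiv> \<Sum>i = 1..p. m i"
  shows "abs_mat (1\<^sub>m (N + n) - mat_inv (precond_mat p n AII MG) * global_mat p n AII AIG AGI AGG) =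
    four_block_mat (0\<^sub>m N N) (vstack n (\<lambda>i. abs_mat (mat_inv (AII i) * AIG i)) ks)
      (hstack n (\<lambda>i. abs_mat (mat_inv MG * AGI i)) ks)
      (abs_mat (1\<^sub>m n - mat_inv MG * family_sum_mat p n AGG))"
proof -
  have ks: "i \<in> set ks \<longleftrightarrow> i \<in> {1..p}" for i unfolding ks_def by auto
  have N: "sum_list (map m ks) = N"
    using interv_sum_list_conv_sum_set_nat[of m 1 "Suc p"]
    by (simp add: ks_def N_def atLeastLessThanSuc_atLeastAtMost del: upt_Suc)
  define D where "D = diag_block_mat (map AII ks)"
  define D' where "D' = diag_block_mat (map (\<lambda>i. mat_inv (AII i)) ks)"
  define M' where "M' = mat_inv MG"
  define X where "X = vstack n (\<lambda>i. mat_inv (AII i) * AIG i) ks"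
  define Y where "Y = hstack n (\<lambda>i. M' * AGI i) ks"
  define G where "G = family_sum_mat p n AGG"
  note inv = mat_inv_invertible[OF AII AII_inv]
  note M' = mat_inv_invertible[OF MG MG_inv, folded M'_def]
  have D: "D \<in> carrier_mat N N" and D': "D' \<in> carrier_mat N N"
    unfolding D_def D'_def N[symmetric] by (intro diag_block_carrier; use AII inv ks in auto)+
  have DD': "D * D' = 1\<^sub>m N" "D' * D = 1\<^sub>m N"
    unfolding D_def D'_def N[symmetric] by (intro diag_block_mult_inverse; use AII inv ks in auto)+
  have V: "vstack n AIG ks \<in> carrier_mat N n" and H: "hstack n AGI ks \<in> carrier_mat n N"
    unfolding N[symmetric] using AIG AGI ks by (auto intro!: vstack_carrier hstack_carrier)
  have XY: "X \<in> carrier_mat N n" "Y \<in> carrier_mat n N"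
    unfolding X_def Y_def N[symmetric]
    using AIG AGI ks inv M' by (auto intro!: vstack_carrier hstack_carrier mult_carrier_mat)
  have G: "G \<in> carrier_mat n n" by (simp add: G_def family_sum_mat_def)
  have "precond_mat p n AII MG = four_block_mat D (0\<^sub>m N n) (0\<^sub>m n N) MG"
    unfolding precond_mat_def Let_def ks_def[symmetric] D_def[symmetric] using D by simp
  moreover have "mat_inv (four_block_mat D (0\<^sub>m N n) (0\<^sub>m n N) MG) = four_block_mat D' (0\<^sub>m N n) (0\<^sub>m n N) M'"
  proof (rule mat_inv_unique[where n = "N + n"])
    show "four_block_mat D (0\<^sub>m N n) (0\<^sub>m n N) MG * four_block_mat D' (0\<^sub>m N n) (0\<^sub>m n N) M' = 1\<^sub>m (N + n)"
      using D D' MG M' DD' by (simp add: mult_four_block_mat[of _ N N _ n _ n _ _ N _ n])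
  qed (use D D' MG M' in auto)
  moreover have "global_mat p n AII AIG AGI AGG = four_block_mat D (vstack n AIG ks) (hstack n AGI ks) G"
    by (simp add: global_mat_def vstack_def hstack_def D_def G_def ks_def del: upt_Suc)
  moreover have "four_block_mat D' (0\<^sub>m N n) (0\<^sub>m n N) M' * four_block_mat D (vstack n AIG ks) (hstack n AGI ks) G
      = four_block_mat (1\<^sub>m N) X Y (M' * G)"
  proof -
    have "D' * vstack n AIG ks = X"
      unfolding D'_def X_def by (rule diag_block_mult_vstack) (use inv AIG ks in auto)
    moreover have "M' * hstack n AGI ks = Y"
      unfolding Y_def by (rule mult_hstack[OF M'(1)]) (use AGI ks in auto)
    ultimately show ?thesis
      using D D' V H M' G XY DD' by (simp add: mult_four_block_mat[of _ N N _ n _ n _ _ N _ n])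
  qed
  moreover have "1\<^sub>m (N + n) - four_block_mat (1\<^sub>m N) X Y (M' * G)
      = four_block_mat (0\<^sub>m N N) (- X) (- Y) (1\<^sub>m n - M' * G)"
    using XY M' G by (intro eq_matI) auto
  moreover have "abs_mat (four_block_mat (0\<^sub>m N N) (- X) (- Y) (1\<^sub>m n - M' * G))
      = four_block_mat (abs_mat (0\<^sub>m N N :: 'a mat)) (abs_mat (- X)) (abs_mat (- Y)) (abs_mat (1\<^sub>m n - M' * G))"
    using XY M' G
    by (intro abs_four_block_mat[of _ N N _ n _ n] minus_carrier_mat mult_carrier_mat) auto
  ultimately have "abs_mat (1\<^sub>m (N + n) - mat_inv (precond_mat p n AII MG) * global_mat p n AII AIG AGI AGG)
      = four_block_mat (abs_mat (0\<^sub>m N N :: 'a mat)) (abs_mat (- X)) (abs_mat (- Y)) (abs_mat (1\<^sub>m n - M' * G))"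
    by simp
  also have "abs_mat (0\<^sub>m N N :: 'a mat) = 0\<^sub>m N N" by (auto simp: abs_mat_def)
  also have "abs_mat (- X) = map_mat norm X" by (auto simp: abs_mat_def)
  also have "\<dots> = vstack n (\<lambda>i. abs_mat (mat_inv (AII i) * AIG i)) ks"
    unfolding X_def abs_mat_def by (rule map_mat_vstack[where m = m]) (use inv AIG ks in \<open>auto intro!: mult_carrier_mat\<close>)
  also have "abs_mat (- Y) = map_mat norm Y" by (auto simp: abs_mat_def)
  also have "\<dots> = hstack n (\<lambda>i. abs_mat (mat_inv MG * AGI i)) ks"
    unfolding Y_def abs_mat_def M'_def[symmetric] by (rule map_mat_hstack[where m = m]) (use M' AGI ks in \<open>auto intro!: mult_carrier_mat\<close>)
  finally show ?thesis by (simp add: M'_def G_def)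
qed

text \<open>
  The upper rows of \<open>T w < w\<close> for \<open>w = (u, g)\<close> say \<open>X g < u\<close>. Substituting this into the lower rows
  \<open>Y u + Z g < g\<close>, with \<open>Y \<ge> 0\<close>, eliminates \<open>u\<close>.
\<close>

lemma block_elimination_contraction:
  fixes X Y Z :: "real mat"
  assumes X: "X \<in> carrier_mat N n" and Y: "Y \<in> carrier_mat n N" and Z: "Z \<in> carrier_mat n n"
    and Y_nonneg: "nonneg_entries Y"
    and w: "w \<in> carrier_vec (N + n)"
    and contr: "\<And>r. r < N + n \<Longrightarrow> (four_block_mat (0\<^sub>m N N) X Y Z *\<^sub>v w) $ r < w $ r"
    and r: "r < n"
  shows "((Y * X + Z) *\<^sub>v vec_last w n) $ r < vec_last w n $ r"
proof -
  define u where "u = vec_first w N"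
  define g where "g = vec_last w n"
  have ug: "u \<in> carrier_vec N" "g \<in> carrier_vec n" by (auto simp: u_def g_def)
  have w_eq: "w = u @\<^sub>v g" unfolding u_def g_def by (rule vec_first_last_append[OF w, symmetric])
  have prod: "four_block_mat (0\<^sub>m N N) X Y Z *\<^sub>v w = (X *\<^sub>v g) @\<^sub>v (Y *\<^sub>v u + Z *\<^sub>v g)"
    unfolding w_eq using ug X Y Z by (subst four_block_mat_mult_vec[of _ N N _ n _ n]) auto
  have upper: "(X *\<^sub>v g) $ s < u $ s" if "s < N" for s
    using contr[of s] that ug X Y Z unfolding prod by (simp add: w_eq)
  have lower: "(Y *\<^sub>v u) $ r + (Z *\<^sub>v g) $ r < g $ r"
    using contr[of "N + r"] r ug X Y Z unfolding prod by (simp add: w_eq)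
  have "(Y * X *\<^sub>v g) $ r = (\<Sum>s<N. Y $$ (r, s) * (X *\<^sub>v g) $ s)"
    using r ug X Y by (subst assoc_mult_mat_vec[OF Y X ug(2)])
      (auto simp: scalar_prod_def atLeast0LessThan intro!: sum.cong)
  also have "\<dots> \<le> (\<Sum>s<N. Y $$ (r, s) * u $ s)"
    using upper Y_nonneg Y r
    by (intro sum_mono mult_left_mono) (auto simp: nonneg_entries_def less_imp_le)
  also have "\<dots> = (Y *\<^sub>v u) $ r"
    using r ug Y by (auto simp: scalar_prod_def atLeast0LessThan intro!: sum.cong)
  finally have "((Y * X + Z) *\<^sub>v g) $ r \<le> (Y *\<^sub>v u) $ r + (Z *\<^sub>v g) $ r"
    using r ug X Y Z by (simp add: add_mult_distrib_mat_vec[of _ n n])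
  with lower show ?thesis by (simp add: g_def)
qed

section \<open>Convergence of the asynchronous Schur iteration\<close>

lemma mult_mat_vec_entry:
  assumes "A \<in> carrier_mat n n" "v \<in> carrier_vec n" "r < n"
  shows "(A *\<^sub>v v) $ r = (\<Sum>c<n. A $$ (r, c) * v $ c)"
  using assms by (auto simp: scalar_prod_def atLeast0LessThan intro!: sum.cong)

lemma mult_mat_entry:
  assumes "A \<in> carrier_mat n k" "B \<in> carrier_mat k l" "r < n" "c < l"
  shows "(A * B) $$ (r, c) = (\<Sum>s<k. A $$ (r, s) * B $$ (s, c))"
  using assms by (auto simp: scalar_prod_def atLeast0LessThan intro!: sum.cong)

lemma family_sum_mat_mult_vec:
  fixes F :: "nat \<Rightarrow> 'a :: comm_ring_1 mat"
  assumes "\<And>i. i \<in> {1..p} \<Longrightarrow> F i \<in> carrier_mat n n" "v \<in> carrier_vec n" "r < n"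
  shows "(family_sum_mat p n F *\<^sub>v v) $ r = (\<Sum>i=1..p. (F i *\<^sub>v v) $ r)"
proof -
  have "(family_sum_mat p n F *\<^sub>v v) $ r = (\<Sum>c<n. \<Sum>i=1..p. F i $$ (r, c) * v $ c)"
    using assms by (subst mult_mat_vec_entry[where n = n]) (auto simp: family_sum_mat_def sum_distrib_right)
  also have "\<dots> = (\<Sum>i=1..p. (F i *\<^sub>v v) $ r)"
    using assms by (subst sum.swap) (intro sum.cong refl mult_mat_vec_entry[symmetric]; simp)
  finally show ?thesis .
qed

lemma schur_local_update_diff:
  fixes S :: "'a :: field mat"
  assumes S: "S \<in> carrier_mat n n" and J: "J \<in> carrier_mat n n" and d: "d \<in> carrier_vec n"
    and M': "mat_inv MG \<in> carrier_mat n n"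
    and x: "x \<in> carrier_vec n" "z \<in> carrier_vec n" and r: "r < n"
  shows "schur_local_update S d J MG x $ r - schur_local_update S d J MG z $ r =
    (\<Sum>c<n. (J - mat_inv MG * S) $$ (r, c) * (x $ c - z $ c))"
proof -
  have U: "schur_local_update S d J MG y $ r = ((J - mat_inv MG * S) *\<^sub>v y) $ r + (mat_inv MG *\<^sub>v d) $ r"
    if y: "y \<in> carrier_vec n" for y
  proof -
    have "mat_inv MG *\<^sub>v (d - S *\<^sub>v y) = mat_inv MG *\<^sub>v d - mat_inv MG * S *\<^sub>v y"
      using S M' d y by (simp add: mult_minus_distrib_mat_vec[of _ n n] assoc_mult_mat_vec[of _ n n _ n])
    moreover have "(J - mat_inv MG * S) *\<^sub>v y = J *\<^sub>v y - mat_inv MG * S *\<^sub>v y"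
      using S M' J y by (intro minus_mult_distrib_mat_vec[of _ n n]) auto
    ultimately show ?thesis
      using S M' J d y r by (simp add: schur_local_update_def)
  qed
  have "J - mat_inv MG * S \<in> carrier_mat n n"
    using S M' by (intro minus_carrier_mat mult_carrier_mat)
  note entry = mult_mat_vec_entry[OF this _ r]
  show ?thesis
    unfolding U[OF x(1)] U[OF x(2)] entry[OF x(1)] entry[OF x(2)]
    by (simp add: right_diff_distrib sum_subtractf)
qed

text \<open>
  Only the sum over the subdomains is stationary: the residuals \<open>d i - S i z\<close> cancel in total, while a
  single one need not vanish.
\<close>

lemma solution_is_fixed_point:
  fixes S :: "nat \<Rightarrow> 'a :: field mat"
  assumes S: "\<And>i. i \<in> {1..p} \<Longrightarrow> S i \<in> carrier_mat n n"
    and J: "\<And>i. i \<in> {1..p} \<Longrightarrow> J i \<in> carrier_mat n n"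
    and d: "\<And>i. i \<in> {1..p} \<Longrightarrow> d i \<in> carrier_vec n"
    and M': "mat_inv MG \<in> carrier_mat n n"
    and J_sum: "family_sum_mat p n J = 1\<^sub>m n"
    and z: "z \<in> carrier_vec n" "family_sum_mat p n S *\<^sub>v z = family_sum_vec p n d"
    and r: "r < n"
  shows "(\<Sum>i=1..p. schur_local_update (S i) (d i) (J i) MG z $ r) = z $ r"
proof -
  have residual: "(\<Sum>i=1..p. (d i - S i *\<^sub>v z) $ s) = 0" if s: "s < n" for s
  proof -
    have "(\<Sum>i=1..p. (d i - S i *\<^sub>v z) $ s) = (\<Sum>i=1..p. d i $ s - (S i *\<^sub>v z) $ s)"
      using S d s by (intro sum.cong refl index_minus_vec) auto
    also have "\<dots> = family_sum_vec p n d $ s - (family_sum_mat p n S *\<^sub>v z) $ s"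
      using family_sum_mat_mult_vec[OF S z(1) s] s by (simp add: sum_subtractf family_sum_vec_def)
    finally show ?thesis using z by simp
  qed
  have "(\<Sum>i=1..p. schur_local_update (S i) (d i) (J i) MG z $ r) =
      (\<Sum>i=1..p. (J i *\<^sub>v z) $ r + (\<Sum>s<n. mat_inv MG $$ (r, s) * (d i - S i *\<^sub>v z) $ s))"
  proof (intro sum.cong refl)
    fix i assume i: "i \<in> {1..p}"
    have "d i - S i *\<^sub>v z \<in> carrier_vec n" using S[OF i] d[OF i] z(1) by (intro minus_carrier_vec mult_mat_vec_carrier)
    from mult_mat_vec_entry[OF M' this r]
    show "schur_local_update (S i) (d i) (J i) MG z $ r =
        (J i *\<^sub>v z) $ r + (\<Sum>s<n. mat_inv MG $$ (r, s) * (d i - S i *\<^sub>v z) $ s)"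
      using r M' J[OF i] by (simp add: schur_local_update_def del: index_mult_mat_vec)
  qed
  also have "\<dots> = (family_sum_mat p n J *\<^sub>v z) $ r +
      (\<Sum>s<n. mat_inv MG $$ (r, s) * (\<Sum>i=1..p. (d i - S i *\<^sub>v z) $ s))"
    unfolding sum.distrib sum_distrib_left
    by (subst family_sum_mat_mult_vec[where F = J]) (use J z r in \<open>auto intro: sum.swap\<close>)
  also have "\<dots> = z $ r" using residual z by (simp add: J_sum)
  finally show ?thesis .
qed

text \<open>
  The errors satisfy the hypotheses of \<open>async_contraction\<close> with \<open>Q j r c\<close> the absolute entries of the
  linear part of update \<open>j\<close>. A kernel vector of the summed Schur complement is covered by that lemma
  too: it is a constant error of a single synchronous process, and constant sequences tending to zero
  are zero.
\<close>

lemma async_schur_convergent_if_contraction: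
  fixes S :: "nat \<Rightarrow> 'a :: real_normed_field mat"
  assumes S: "\<And>i. i \<in> {1..p} \<Longrightarrow> S i \<in> carrier_mat n n"
    and J: "\<And>i. i \<in> {1..p} \<Longrightarrow> J i \<in> carrier_mat n n"
    and d: "\<And>i. i \<in> {1..p} \<Longrightarrow> d i \<in> carrier_vec n"
    and M': "mat_inv MG \<in> carrier_mat n n"
    and J_sum: "family_sum_mat p n J = 1\<^sub>m n"
    and g_pos: "\<And>r. r < n \<Longrightarrow> g r > 0"
    and contr: "\<And>r. r < n \<Longrightarrow>
      (\<Sum>i=1..p. \<Sum>c<n. norm ((J i - mat_inv MG * S i) $$ (r, c)) * g c) < g r"
  shows "async_schur_convergent p n S d J MG"
proof -
  define Q where "Q j r c = norm ((J j - mat_inv MG * S j) $$ (r, c))" for j r c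
  define SG where "SG = family_sum_mat p n S"
  have SG: "SG \<in> carrier_mat n n" by (simp add: SG_def family_sum_mat_def)
  have update_error: "norm ((\<Sum>j=1..p. schur_local_update (S j) (f j) (J j) MG (y j) $ r) - z $ r)
      \<le> (\<Sum>j=1..p. \<Sum>c<n. Q j r c * norm (y j $ c - z $ c))"
    if f: "\<And>j. j \<in> {1..p} \<Longrightarrow> f j \<in> carrier_vec n"
      and z: "z \<in> carrier_vec n" "SG *\<^sub>v z = family_sum_vec p n f"
      and y: "\<And>j. j \<in> {1..p} \<Longrightarrow> y j \<in> carrier_vec n" and r: "r < n" for f y z r
  proof -
    have "(\<Sum>j=1..p. schur_local_update (S j) (f j) (J j) MG (y j) $ r) - z $ r =
        (\<Sum>j=1..p. schur_local_update (S j) (f j) (J j) MG (y j) $ r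
          - schur_local_update (S j) (f j) (J j) MG z $ r)"
      using solution_is_fixed_point[OF S J f M' J_sum z(1) z(2)[unfolded SG_def] r]
      by (simp add: sum_subtractf)
    also have "\<dots> = (\<Sum>j=1..p. \<Sum>c<n. (J j - mat_inv MG * S j) $$ (r, c) * (y j $ c - z $ c))"
      using S J f M' y z r by (intro sum.cong refl schur_local_update_diff) auto
    also have "norm \<dots> \<le> (\<Sum>j=1..p. \<Sum>c<n. Q j r c * norm (y j $ c - z $ c))"
      by (intro sum_norm_le) (simp add: Q_def norm_mult)
    finally show ?thesis .
  qed
  have kernel: "v = 0\<^sub>v n" if v: "v \<in> carrier_vec n" "SG *\<^sub>v v = 0\<^sub>v n" for v
  proof (rule eq_vecI)
    fix r assume "r < dim_vec (0\<^sub>v n :: 'a vec)"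
    hence r: "r < n" by simp
    have le: "norm (v $ s) \<le> (\<Sum>c<n. (\<Sum>j=1..p. Q j s c) * norm (v $ c))" if s: "s < n" for s
    proof -
      have Sv: "SG *\<^sub>v v = family_sum_vec p n (\<lambda>_. 0\<^sub>v n)"
        using v by (auto simp: family_sum_vec_def)
      have "A *\<^sub>v 0\<^sub>v n = 0\<^sub>v n" if "A \<in> carrier_mat n n" for A :: "'a mat"
        using that by (intro eq_vecI) auto
      hence "schur_local_update (S j) (0\<^sub>v n) (J j) MG (0\<^sub>v n) = 0\<^sub>v n" if "j \<in> {1..p}" for j
        using S[OF that] J[OF that] M' by (auto simp: schur_local_update_def)
      \<comment> \<open>With zero right-hand side \<open>v\<close> is itself a solution, compared here with the zero vector.\<close>
      with update_error[OF _ v(1) Sv, of "\<lambda>_. 0\<^sub>v n" s] s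
      have "norm (v $ s) \<le> (\<Sum>j=1..p. \<Sum>c<n. Q j s c * norm (v $ c))" by simp
      also have "\<dots> = (\<Sum>c<n. (\<Sum>j=1..p. Q j s c) * norm (v $ c))"
        by (subst sum.swap) (simp add: sum_distrib_right)
      finally show ?thesis .
    qed
    have "(\<lambda>k::nat. norm (v $ r)) \<longlonglongrightarrow> 0"
    proof (rule async_contraction[of 1 "\<lambda>_. {1}" "\<lambda>_ _ k. k" "\<lambda>_ _ r. norm (v $ r)"
          "\<lambda>_ r c. \<Sum>j=1..p. Q j r c" n g 1])
      show "async_schedule 1 (\<lambda>_. {1}) (\<lambda>_ _ k. k)"
        by (auto simp: async_schedule_def filterlim_ident)
      show "(\<Sum>l=1..1::nat. \<Sum>c<n. (\<Sum>j=1..p. Q j s c) * g c) < g s" if "s < n" for s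
      proof -
        have "(\<Sum>c<n. (\<Sum>j=1..p. Q j s c) * g c) = (\<Sum>j=1..p. \<Sum>c<n. Q j s c * g c)"
          unfolding sum_distrib_right by (rule sum.swap)
        with contr[OF that] show ?thesis by (simp add: Q_def)
      qed
    qed (use r le g_pos in \<open>auto simp: Q_def intro: sum_nonneg\<close>)
    hence "norm (v $ r) = 0" by (simp add: LIMSEQ_const_iff)
    thus "v $ r = 0\<^sub>v n $ r" using r by simp
  qed (use v in auto)
  have "det SG \<noteq> 0" using kernel det_0_iff_vec_prod_zero_field[OF SG] by auto
  from det_non_zero_imp_unit[OF SG this, of "()"] obtain B
    where B: "B \<in> carrier_mat n n" "B * SG = 1\<^sub>m n" "SG * B = 1\<^sub>m n"
    unfolding Units_def ring_mat_def by auto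
  define f where "f = family_sum_vec p n d"
  have f: "f \<in> carrier_vec n" by (simp add: f_def family_sum_vec_def)
  define z where "z = B *\<^sub>v f"
  have z: "z \<in> carrier_vec n" using B f by (simp add: z_def)
  have Sz: "SG *\<^sub>v z = f"
    using assoc_mult_mat_vec[OF SG B(1) f] B f by (simp add: z_def)
  have "v = z" if "v \<in> carrier_vec n" "SG *\<^sub>v v = f" for v
    using assoc_mult_mat_vec[OF B(1) SG that(1)] that B by (simp add: z_def)
  with z Sz have unique: "{v \<in> carrier_vec n. SG *\<^sub>v v = f} = {z}" by blast
  have "(\<lambda>k. x i k $ r) \<longlonglongrightarrow> z $ r"
    if sched: "async_schedule p P \<tau>" and run: "async_schur_run p n S d J MG P \<tau> x"
      and i: "i \<in> {1..p}" and r: "r < n" for P \<tau> x i r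
  proof -
    have x: "x j k \<in> carrier_vec n" if "j \<in> {1..p}" for j k
    proof (induction k)
      case (Suc k)
      have "x j (Suc k) = (if j \<in> P k
         then family_sum_vec p n (\<lambda>l. schur_local_update (S l) (d l) (J l) MG (x l (\<tau> l j k)))
         else x j k)"
        using run that unfolding async_schur_run_def by blast
      with Suc show ?case by (simp add: family_sum_vec_def)
    qed (use run that in \<open>auto simp: async_schur_run_def\<close>)
    have "(\<lambda>k. norm (x i k $ r - z $ r)) \<longlonglongrightarrow> 0"
    proof (rule async_contraction[of p P \<tau> "\<lambda>i k r. norm (x i k $ r - z $ r)" Q n g i])
      fix j k s assume j: "j \<in> {1..p}" and s: "s < n"
      have upd: "x j (Suc k) = (if j \<in> P k
         then family_sum_vec p n (\<lambda>l. schur_local_update (S l) (d l) (J l) MG (x l (\<tau> l j k)))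
         else x j k)"
        using run j unfolding async_schur_run_def by blast
      show "norm (x j (Suc k) $ s - z $ s) = norm (x j k $ s - z $ s)" if "j \<notin> P k"
        using upd that by simp
      show "norm (x j (Suc k) $ s - z $ s) \<le>
          (\<Sum>l=1..p. \<Sum>c<n. Q l s c * norm (x l (\<tau> l j k) $ c - z $ c))" if "j \<in> P k"
        using update_error[OF d z Sz[unfolded f_def] x s, of "\<lambda>l. l" "\<lambda>l. \<tau> l j k"] upd that s
        by (simp add: family_sum_vec_def)
    qed (use sched g_pos contr i r in \<open>auto simp: Q_def\<close>)
    hence "(\<lambda>k. x i k $ r - z $ r) \<longlonglongrightarrow> 0" by (rule tendsto_norm_zero_cancel)
    thus ?thesis by (simp add: LIM_zero_iff)
  qed
  with unique show ?thesis
    unfolding async_schur_convergent_def SG_def f_def by blast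
qed

section \<open>Bounding the local operators by the global iteration matrix\<close>

lemma diagonal_inverse_mult_entry:
  fixes MG :: "'a :: field mat"
  assumes MG: "MG \<in> carrier_mat n n" "diagonal_mat MG" "invertible_mat MG"
    and B: "B \<in> carrier_mat n k" and rc: "r < n" "c < k"
  shows "(mat_inv MG * B) $$ (r, c) = mat_inv MG $$ (r, r) * B $$ (r, c)"
proof -
  note M' = mat_inv_invertible[OF MG(1,3)]
  have prod: "MG $$ (r, r) * mat_inv MG $$ (r, s) = (if r = s then 1 else 0)" if s: "s < n" for s
  proof -
    have "(\<Sum>t<n. MG $$ (r, t) * mat_inv MG $$ (t, s)) = (MG * mat_inv MG) $$ (r, s)"
      using mult_mat_entry[OF MG(1) M'(1) rc(1) s] by simp
    also have "\<dots> = (if r = s then 1 else 0)" using rc s by (simp add: M'(2))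
    also have "(\<Sum>t<n. MG $$ (r, t) * mat_inv MG $$ (t, s))
        = (\<Sum>t<n. if t = r then MG $$ (r, r) * mat_inv MG $$ (r, s) else 0)"
      using MG rc by (intro sum.cong) (auto simp: diagonal_mat_def)
    finally show ?thesis using rc by simp
  qed
  have "MG $$ (r, r) \<noteq> 0" using prod[OF rc(1)] by auto
  hence off: "mat_inv MG $$ (r, s) = 0" if "s < n" "s \<noteq> r" for s
    using prod[OF that(1)] that by auto
  have "(mat_inv MG * B) $$ (r, c) = (\<Sum>s<n. if s = r then mat_inv MG $$ (r, r) * B $$ (r, c) else 0)"
    unfolding mult_mat_entry[OF M'(1) B rc] using off by (intro sum.cong) auto
  thus ?thesis using rc by simp
qed

text \<open>
  If \<open>t = 0\<close> both sides vanish; otherwise the weights sum to \<open>1\<close>.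
\<close>

lemma norm_sum_proportional:
  fixes t :: "'a :: real_normed_field" and w :: "'b \<Rightarrow> real"
  assumes w: "\<And>i. i \<in> I \<Longrightarrow> w i \<ge> 0" and t: "(\<Sum>i\<in>I. of_real (w i) * t) = t"
  shows "(\<Sum>i\<in>I. norm (of_real (w i) * t)) = norm t"
proof -
  have "(\<Sum>i\<in>I. norm (of_real (w i) * t)) = (\<Sum>i\<in>I. w i * norm t)"
    using w by (intro sum.cong) (auto simp: norm_mult)
  also have "\<dots> = norm (of_real (\<Sum>i\<in>I. w i) * t)"
    using w by (simp add: norm_mult sum_distrib_right[symmetric] sum_nonneg del: of_real_sum)
  also have "of_real (\<Sum>i\<in>I. w i) * t = t" using t by (simp add: sum_distrib_right)
  finally show ?thesis .
qed

text \<open>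
  This is where the weights and the diagonal form of \<open>MG\<close> enter. Left multiplication by the inverse of
  \<open>MG\<close> scales rows, so it commutes with entrywise weighting and
  \<open>J i - MG\<^sup>-\<^sup>1 B i = W i \<circ> (I - MG\<^sup>-\<^sup>1 \<Sum>B)\<close>. All summands at one position are non-negative multiples of
  one scalar, and the triangle inequality between them is an equality.
\<close>

lemma weighted_splitting_norm_sum:
  fixes MG :: "'a :: real_normed_field mat"
  assumes MG: "MG \<in> carrier_mat n n" "diagonal_mat MG" "invertible_mat MG"
    and B: "\<And>i. i \<in> {1..p} \<Longrightarrow> B i \<in> carrier_mat n n"
    and J_sum: "family_sum_mat p n J = 1\<^sub>m n"
    and W: "\<And>i. i \<in> {1..p} \<Longrightarrow> W i \<in> carrier_mat n n"
    and W_nonneg: "\<And>i. i \<in> {1..p} \<Longrightarrow> nonneg_entries (W i)"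
    and B_W: "\<And>i. i \<in> {1..p} \<Longrightarrow>
      B i = hadamard_mat (map_mat of_real (W i)) (family_sum_mat p n B)"
    and J_W: "\<And>i. i \<in> {1..p} \<Longrightarrow> J i = hadamard_mat (map_mat of_real (W i)) (1\<^sub>m n)"
    and rc: "r < n" "c < n"
  shows "(\<Sum>i = 1..p. norm ((J i - mat_inv MG * B i) $$ (r, c))) =
    norm ((1\<^sub>m n - mat_inv MG * family_sum_mat p n B) $$ (r, c))"
proof -
  define M' where "M' = mat_inv MG"
  define t where "t = (1\<^sub>m n - M' * family_sum_mat p n B) $$ (r, c)"
  have G: "family_sum_mat p n B \<in> carrier_mat n n" by (simp add: family_sum_mat_def)
  have M': "M' \<in> carrier_mat n n"
    unfolding M'_def by (rule mat_inv_invertible(1)[OF MG(1,3)])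
  note diag = diagonal_inverse_mult_entry[OF MG _ rc, folded M'_def]
  have minus_entry: "(C - M' * F) $$ (r, c) = C $$ (r, c) - M' $$ (r, r) * F $$ (r, c)"
    if "F \<in> carrier_mat n n" for C F
  proof -
    have "(C - M' * F) $$ (r, c) = C $$ (r, c) - (M' * F) $$ (r, c)"
      using rc that M' by (intro index_minus_mat) auto
    thus ?thesis by (simp only: diag[OF that])
  qed
  have entry: "(J i - M' * B i) $$ (r, c) = of_real (W i $$ (r, c)) * t"
    if i: "i \<in> {1..p}" for i
  proof -
    have had: "hadamard_mat (map_mat of_real (W i)) F $$ (r, c) = of_real (W i $$ (r, c)) * F $$ (r, c)"
      for F :: "'a mat" using W[OF i] rc by (simp add: hadamard_mat_def)
    have "B i $$ (r, c) = of_real (W i $$ (r, c)) * family_sum_mat p n B $$ (r, c)"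
      using had by (subst B_W[OF i])
    moreover have "J i $$ (r, c) = of_real (W i $$ (r, c)) * 1\<^sub>m n $$ (r, c)"
      using had by (subst J_W[OF i])
    ultimately show ?thesis
      unfolding t_def minus_entry[OF B[OF i]] minus_entry[OF G] by (simp only: algebra_simps)
  qed
  have "(\<Sum>i = 1..p. of_real (W i $$ (r, c)) * t) = (\<Sum>i = 1..p. (J i - M' * B i) $$ (r, c))"
    using entry by simp
  also have "\<dots> = (\<Sum>i = 1..p. J i $$ (r, c) - M' $$ (r, r) * B i $$ (r, c))"
    by (intro sum.cong refl minus_entry B)
  also have "\<dots> = family_sum_mat p n J $$ (r, c) - M' $$ (r, r) * family_sum_mat p n B $$ (r, c)"
    using rc by (simp add: family_sum_mat_def sum_subtractf sum_distrib_left)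
  also have "\<dots> = t" unfolding t_def minus_entry[OF G] J_sum ..
  finally have total: "(\<Sum>i = 1..p. of_real (W i $$ (r, c)) * t) = t" .
  have "0 \<le> W i $$ (r, c)" if "i \<in> {1..p}" for i
    using W_nonneg[OF that] W[OF that] rc by (simp add: nonneg_entries_def)
  from norm_sum_proportional[OF this total]
  have "(\<Sum>i = 1..p. norm (of_real (W i $$ (r, c)) * t)) = norm t" .
  thus ?thesis using entry by (simp add: t_def M'_def)
qed

text \<open>
  \<open>J - M S = (J - M D) + (M C) (A\<^sup>-\<^sup>1 B)\<close> for \<open>S = D - C A\<^sup>-\<^sup>1 B\<close>; the bracketing of the second term
  matches the off-diagonal blocks of the global iteration matrix.
\<close>

lemma local_operator_entry_bound:
  fixes J M A B C D :: "'a :: real_normed_field mat"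
  assumes J: "J \<in> carrier_mat n n" and M: "M \<in> carrier_mat n n"
    and A': "mat_inv A \<in> carrier_mat m m"
    and B: "B \<in> carrier_mat m n" and C: "C \<in> carrier_mat n m" and D: "D \<in> carrier_mat n n"
    and rc: "r < n" "c < n"
  shows "norm ((J - M * schur_mat A B C D) $$ (r, c)) \<le>
    norm ((J - M * D) $$ (r, c)) + (abs_mat (M * C) * abs_mat (mat_inv A * B)) $$ (r, c)"
proof -
  define X where "X = mat_inv A * B"
  define Y where "Y = M * C"
  have X: "X \<in> carrier_mat m n" unfolding X_def by (rule mult_carrier_mat[OF A' B])
  have Y: "Y \<in> carrier_mat n m" unfolding Y_def by (rule mult_carrier_mat[OF M C])
  have "M * (C * mat_inv A * B) = Y * X"
    unfolding X_def Y_def using M C B A'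
    by (simp add: assoc_mult_mat[of _ n n _ m _ n] assoc_mult_mat[of _ n m _ m _ n])
  hence "M * schur_mat A B C D = M * D - Y * X"
    unfolding schur_mat_def using M C B A' D
    by (subst mult_minus_distrib_mat[of _ n n _ n]) auto
  hence "(J - M * schur_mat A B C D) $$ (r, c) = (J - M * D) $$ (r, c) + (Y * X) $$ (r, c)"
    using rc M D J X Y by (simp del: index_mult_mat(1))
  hence "norm ((J - M * schur_mat A B C D) $$ (r, c))
      \<le> norm ((J - M * D) $$ (r, c)) + norm ((Y * X) $$ (r, c))"
    by (metis norm_triangle_ineq)
  also have "norm ((Y * X) $$ (r, c)) \<le> (abs_mat Y * abs_mat X) $$ (r, c)"
  proof -
    have abs: "abs_mat Y \<in> carrier_mat n m" "abs_mat X \<in> carrier_mat m n"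
      using X Y by (auto simp: abs_mat_def)
    have "norm ((Y * X) $$ (r, c)) \<le> (\<Sum>s<m. abs_mat Y $$ (r, s) * abs_mat X $$ (s, c))"
      unfolding mult_mat_entry[OF Y X rc]
      using X Y rc by (intro sum_norm_le) (auto simp: abs_mat_def norm_mult)
    also have "\<dots> = (abs_mat Y * abs_mat X) $$ (r, c)"
      by (rule mult_mat_entry[symmetric, OF abs rc])
    finally show ?thesis .
  qed
  finally show ?thesis by (simp add: X_def Y_def)
qed

section \<open>Convergence from the spectral radius of the global iteration matrix\<close>

theorem corollary3:
  fixes p n :: nat and m :: "nat \<Rightarrow> nat"
    and AII AIG AGI AGG J :: "nat \<Rightarrow> 'a :: real_normed_field mat"
    and bI bG :: "nat \<Rightarrow> 'a vec"
    and MG :: "'a mat"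
    and W :: "nat \<Rightarrow> real mat"
  assumes AII: "\<And>i. i \<in> {1..p} \<Longrightarrow> AII i \<in> carrier_mat (m i) (m i)"
    and AII_inv: "\<And>i. i \<in> {1..p} \<Longrightarrow> invertible_mat (AII i)"
    and AIG: "\<And>i. i \<in> {1..p} \<Longrightarrow> AIG i \<in> carrier_mat (m i) n"
    and AGI: "\<And>i. i \<in> {1..p} \<Longrightarrow> AGI i \<in> carrier_mat n (m i)"
    and AGG: "\<And>i. i \<in> {1..p} \<Longrightarrow> AGG i \<in> carrier_mat n n"
    and bI: "\<And>i. i \<in> {1..p} \<Longrightarrow> bI i \<in> carrier_vec (m i)"
    and bG: "\<And>i. i \<in> {1..p} \<Longrightarrow> bG i \<in> carrier_vec n"
    and MG: "MG \<in> carrier_mat n n"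
    and MG_inv: "invertible_mat MG"
    and J: "\<And>i. i \<in> {1..p} \<Longrightarrow> J i \<in> carrier_mat n n"
    and J_sum: "family_sum_mat p n J = 1\<^sub>m n"
    and W: "\<And>i. i \<in> {1..p} \<Longrightarrow> W i \<in> carrier_mat n n"
    and W_nonneg: "\<And>i. i \<in> {1..p} \<Longrightarrow> nonneg_entries (W i)"
    and AGG_W: "\<And>i. i \<in> {1..p} \<Longrightarrow>
      AGG i = hadamard_mat (map_mat of_real (W i)) (family_sum_mat p n AGG)"
    and J_W: "\<And>i. i \<in> {1..p} \<Longrightarrow> J i = hadamard_mat (map_mat of_real (W i)) (1\<^sub>m n)"
    and MG_diag: "diagonal_mat MG"
    and rho: "real_spectral_radius (abs_mat (1\<^sub>m ((\<Sum>i = 1..p. m i) + n) -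
      mat_inv (precond_mat p n AII MG) * global_mat p n AII AIG AGI AGG)) < 1"
  shows "async_schur_convergent p n
    (\<lambda>i. schur_mat (AII i) (AIG i) (AGI i) (AGG i))
    (\<lambda>i. schur_rhs (AII i) (AGI i) (bI i) (bG i)) J MG"
proof -
  define M' where "M' = mat_inv MG"
  define S where "S i = schur_mat (AII i) (AIG i) (AGI i) (AGG i)" for i
  define X where "X i = mat_inv (AII i) * AIG i" for i
  define Y where "Y i = M' * AGI i" for i
  define K where "K = 1\<^sub>m n - M' * family_sum_mat p n AGG"
  define ks where "ks = [1..<Suc p]"
  define N where "N = (\<Sum>i = 1..p. m i)"
  define XA where "XA = vstack n (\<lambda>i. abs_mat (X i)) ks"
  define YA where "YA = hstack n (\<lambda>i. abs_mat (Y i)) ks"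
  define T where "T = four_block_mat (0\<^sub>m N N) XA YA (abs_mat K)"
  have ks: "i \<in> set ks \<longleftrightarrow> i \<in> {1..p}" for i unfolding ks_def by auto
  have ks_sum: "(\<Sum>i\<leftarrow>ks. f i) = (\<Sum>i = 1..p. f i)" for f :: "nat \<Rightarrow> 'b :: comm_monoid_add"
    using interv_sum_list_conv_sum_set_nat[of f 1 "Suc p"]
    by (simp add: ks_def atLeastLessThanSuc_atLeastAtMost del: upt_Suc)
  note AII' = mat_inv_invertible[OF AII AII_inv]
  note M' = mat_inv_invertible[OF MG MG_inv, folded M'_def]
  have X: "X i \<in> carrier_mat (m i) n" if "i \<in> {1..p}" for i
    unfolding X_def by (rule mult_carrier_mat[OF AII'(1)[OF that that] AIG[OF that]])
  have Y: "Y i \<in> carrier_mat n (m i)" if "i \<in> {1..p}" for i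
    unfolding Y_def by (rule mult_carrier_mat[OF M'(1) AGI[OF that]])
  have S: "S i \<in> carrier_mat n n" if "i \<in> {1..p}" for i
    unfolding S_def schur_mat_def using AII'(1)[OF that that] AIG[OF that] AGI[OF that]
    by (intro minus_carrier_mat mult_carrier_mat)
  have d: "schur_rhs (AII i) (AGI i) (bI i) (bG i) \<in> carrier_vec n" if "i \<in> {1..p}" for i
    unfolding schur_rhs_def using AII'(1)[OF that that] AGI[OF that] bI[OF that]
    by (intro minus_carrier_vec mult_mat_vec_carrier mult_carrier_mat bG that)
  have G: "family_sum_mat p n AGG \<in> carrier_mat n n" by (simp add: family_sum_mat_def)
  have K: "K \<in> carrier_mat n n"
    unfolding K_def using M' G by (intro minus_carrier_mat mult_carrier_mat)
  have abs_carrier: "abs_mat B \<in> carrier_mat k l" if "B \<in> carrier_mat k l" for B :: "'a mat" and k l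
    using that by (simp add: abs_mat_def)
  have XA: "XA \<in> carrier_mat N n" and YA: "YA \<in> carrier_mat n N"
    unfolding XA_def YA_def N_def ks_sum[symmetric] using X Y ks
    by (auto intro!: vstack_carrier hstack_carrier abs_carrier)
  have T: "T \<in> carrier_mat (N + n) (N + n)"
    unfolding T_def using XA YA abs_carrier[OF K] by (intro four_block_carrier_mat) auto
  have T_eq: "T = abs_mat (1\<^sub>m (N + n) - mat_inv (precond_mat p n AII MG) * global_mat p n AII AIG AGI AGG)"
    unfolding T_def XA_def YA_def K_def N_def ks_def X_def Y_def M'_def
    by (rule abs_iteration_mat[symmetric, OF AII AII_inv AIG AGI MG MG_inv])
  have T_nonneg: "nonneg_entries T"
    unfolding T_eq by (simp add: nonneg_entries_def abs_mat_def)
  have "real_spectral_radius T < 1" using rho by (simp add: T_eq N_def)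
  from strictly_contracted_positive_vector[OF T T_nonneg this] obtain w
    where w: "w \<in> carrier_vec (N + n)" and w_pos: "\<And>r. r < N + n \<Longrightarrow> 0 < w $ r"
      and w_contr: "\<And>r. r < N + n \<Longrightarrow> (T *\<^sub>v w) $ r < w $ r" by blast
  define g where "g = vec_last w n"
  have g: "g \<in> carrier_vec n" by (simp add: g_def)
  have g_pos: "0 < g $ r" if "r < n" for r
    using that w w_pos[of "N + r"] by (simp add: g_def vec_last_def)
  have YA_nonneg: "nonneg_entries YA"
    unfolding nonneg_entries_def
  proof (intro allI impI)
    fix r c assume "r < dim_row YA" "c < dim_col YA"
    hence rc: "r < n" "c < N" using YA by auto
    hence "YA $$ (r, c) = T $$ (N + r, c)" using XA YA abs_carrier[OF K] by (simp add: T_def)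
    thus "0 \<le> YA $$ (r, c)" using T_nonneg T rc by (simp add: nonneg_entries_def)
  qed
  have g_contr: "((YA * XA + abs_mat K) *\<^sub>v g) $ r < g $ r" if "r < n" for r
    unfolding g_def
    by (rule block_elimination_contraction[OF XA YA abs_carrier[OF K] YA_nonneg w _ that])
      (use w_contr in \<open>simp add: T_def\<close>)
  have sum_bound: "(\<Sum>i = 1..p. norm ((J i - M' * S i) $$ (r, c))) \<le> (YA * XA + abs_mat K) $$ (r, c)"
    if rc: "r < n" "c < n" for r c
  proof -
    have split: "(\<Sum>i = 1..p. norm ((J i - M' * AGG i) $$ (r, c))) = norm (K $$ (r, c))"
      unfolding K_def M'_def
      by (rule weighted_splitting_norm_sum[OF MG MG_diag MG_inv AGG J_sum W W_nonneg AGG_W J_W rc])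
    have "(\<Sum>i = 1..p. norm ((J i - M' * S i) $$ (r, c))) \<le>
        norm (K $$ (r, c)) + (\<Sum>i = 1..p. (abs_mat (Y i) * abs_mat (X i)) $$ (r, c))"
      unfolding split[symmetric] sum.distrib[symmetric]
      unfolding S_def X_def Y_def
      by (intro sum_mono local_operator_entry_bound[OF J M'(1) AII'(1) AIG AGI AGG rc])
    also have "(\<Sum>i = 1..p. (abs_mat (Y i) * abs_mat (X i)) $$ (r, c)) = (YA * XA) $$ (r, c)"
      unfolding XA_def YA_def ks_sum[symmetric]
      by (rule hstack_mult_vstack_entry[symmetric, where m = m]) (use abs_carrier X Y ks rc in auto)
    also have "norm (K $$ (r, c)) + (YA * XA) $$ (r, c) = (YA * XA + abs_mat K) $$ (r, c)"
      using rc K XA YA by (simp add: abs_mat_def del: index_mult_mat(1))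
    finally show ?thesis .
  qed
  have "async_schur_convergent p n S (\<lambda>i. schur_rhs (AII i) (AGI i) (bI i) (bG i)) J MG"
  proof (rule async_schur_convergent_if_contraction[where g = "\<lambda>r. g $ r"])
    fix r assume r: "r < n"
    have "(\<Sum>i = 1..p. \<Sum>c<n. norm ((J i - mat_inv MG * S i) $$ (r, c)) * g $ c) =
        (\<Sum>c<n. (\<Sum>i = 1..p. norm ((J i - M' * S i) $$ (r, c))) * g $ c)"
      unfolding sum_distrib_right M'_def by (rule sum.swap)
    also have "\<dots> \<le> (\<Sum>c<n. (YA * XA + abs_mat K) $$ (r, c) * g $ c)"
      using r g_pos by (intro sum_mono mult_right_mono sum_bound) (auto intro: less_imp_le)
    also have "\<dots> = ((YA * XA + abs_mat K) *\<^sub>v g) $ r"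
      using XA YA abs_carrier[OF K] g r by (intro mult_mat_vec_entry[symmetric]) auto
    also have "\<dots> < g $ r" by (rule g_contr[OF r])
    finally show "(\<Sum>i = 1..p. \<Sum>c<n. norm ((J i - mat_inv MG * S i) $$ (r, c)) * g $ c) < g $ r" .
  qed (use S J d M' J_sum g_pos in \<open>auto simp: M'_def\<close>)
  thus ?thesis unfolding S_def[abs_def] .
qed

end
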